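(* Let the Carter diagram $\widetilde\Gamma$ be the simple extension of the Carter diagram $\Gamma$ (with vertices $\tau_1,\dots,\tau_l$) in the vertex $\tau_p$, such that the vertex $\tau_p$ is connected to the extra vertex $\tau_{l+1}$. Let $\widetilde\gamma^{\vee}$ be a certain linkage diagram (linkage labels vector) for $\widetilde\Gamma$, and let $\gamma^{\vee}$ be the vector obtained from $\widetilde\gamma^{\vee}$ by removing the coordinate $\tau_{l+1}$. If $\gamma^{\vee}\neq0$, then $\gamma^{\vee}$ is a linkage diagram for $\Gamma$.
   Context: Root systems are finite and simply-laced, with $(\alpha,\alpha)=2$ for every root. A (simply-laced) Carter diagram is a graph with vertices $\tau_1,\dots,\tau_l$ and solid/dotted edges, all of whose cycles have even length, realized by linearly independent (not necessarily simple) roots $\tau_i$ of some root system with $(\tau_i,\tau_j)=-1$ (solid edge), $+1$ (dotted edge), $0$ (no edge). $\Gamma$ is simply extendable in the vertex $\tau_p$ if the diagram obtained by adding one extra vertex $\tau_{l+1}$ together with the additional connection edge $\{\tau_p,\tau_{l+1}\}$ (and no other new edge) is again a Carter diagram; this new diagram is the simple extension of $\Gamma$ in $\tau_p$. A linkage labels vector (= linkage diagram) for $\Gamma$ is a nonzero vector $\gamma^{\vee}=((\gamma,\tau_1),\dots,(\gamma,\tau_l))^t$, where $\tau_1,\dots,\tau_l$ are linearly independent roots with diagram $\Gamma$ in some finite simply-laced root system $\varPhi$ and $\gamma\in\varPhi$ is a root not in $\mathrm{span}(\tau_1,\dots,\tau_l)$. *)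

theory Defs
  imports "Jordan_Normal_Form.VS_Connect"
begin

(* The ambient Euclidean space is R^n, the carrier set carrier_vec n with the standard dot
   product.  The dimension is a term, so "some root system" is an honest existential over n and
   \<Phi>; up to isometry every finite-dimensional Euclidean space is of this form. *)

abbreviation span_vec :: "nat \<Rightarrow> real vec set \<Rightarrow> real vec set" where
  "span_vec n \<equiv> LinearCombinations.module.span class_ring (module_vec TYPE(real) n)"

abbreviation lin_indpt_vec :: "nat \<Rightarrow> real vec set \<Rightarrow> bool" where
  "lin_indpt_vec n S \<equiv> \<not> LinearCombinations.module.lin_dep class_ring (module_vec TYPE(real) n) S"

definition reflect :: "real vec \<Rightarrow> real vec \<Rightarrow> real vec" where
  "reflect \<alpha> \<beta> = \<beta> - (2 * (\<beta> \<bullet> \<alpha>) / (\<alpha> \<bullet> \<alpha>)) \<cdot>\<^sub>v \<alpha>"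

(* Finite, reduced, crystallographic; not necessarily irreducible. *)
definition root_system :: "nat \<Rightarrow> real vec set \<Rightarrow> bool" where
  "root_system n \<Phi> \<longleftrightarrow>
     finite \<Phi> \<and> \<Phi> \<subseteq> carrier_vec n \<and> 0\<^sub>v n \<notin> \<Phi> \<and> span_vec n \<Phi> = carrier_vec n \<and>
     (\<forall>\<alpha>\<in>\<Phi>. \<forall>c. c \<cdot>\<^sub>v \<alpha> \<in> \<Phi> \<longleftrightarrow> c = 1 \<or> c = -1) \<and>
     (\<forall>\<alpha>\<in>\<Phi>. reflect \<alpha> ` \<Phi> = \<Phi>) \<and>
     (\<forall>\<alpha>\<in>\<Phi>. \<forall>\<beta>\<in>\<Phi>. 2 * (\<beta> \<bullet> \<alpha>) / (\<alpha> \<bullet> \<alpha>) \<in> \<int>)"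

definition simply_laced_root_system :: "nat \<Rightarrow> real vec set \<Rightarrow> bool" where
  "simply_laced_root_system n \<Phi> \<longleftrightarrow> root_system n \<Phi> \<and> (\<forall>\<alpha>\<in>\<Phi>. \<alpha> \<bullet> \<alpha> = 2)"

(* The vertices are 0, ..., nverts - 1 (vertex i stands for \<tau> with index i + 1); an edge is a
   two-element set of vertices. *)
datatype diagram = Diagram (nverts: nat) (solid: "nat set set") (dotted: "nat set set")

definition wf_diagram :: "diagram \<Rightarrow> bool" where
  "wf_diagram \<Gamma> \<longleftrightarrow>
     solid \<Gamma> \<union> dotted \<Gamma> \<subseteq> {{i, j} | i j. i < nverts \<Gamma> \<and> j < nverts \<Gamma> \<and> i \<noteq> j} \<and>
     solid \<Gamma> \<inter> dotted \<Gamma> = {}"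

definition is_cycle :: "diagram \<Rightarrow> nat list \<Rightarrow> bool" where
  "is_cycle \<Gamma> vs \<longleftrightarrow> 3 \<le> length vs \<and> distinct vs \<and>
     (\<forall>k < length vs. {vs ! k, vs ! (Suc k mod length vs)} \<in> solid \<Gamma> \<union> dotted \<Gamma>)"

definition edge_value :: "diagram \<Rightarrow> nat \<Rightarrow> nat \<Rightarrow> real" where
  "edge_value \<Gamma> i j =
     (if {i, j} \<in> solid \<Gamma> then -1 else if {i, j} \<in> dotted \<Gamma> then 1 else 0)"

(* inj_on is needed because linear independence is stated for the set of the \<tau> i. *)
definition realizes :: "nat \<Rightarrow> real vec set \<Rightarrow> diagram \<Rightarrow> (nat \<Rightarrow> real vec) \<Rightarrow> bool" where
  "realizes n \<Phi> \<Gamma> \<tau> \<longleftrightarrow>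
     simply_laced_root_system n \<Phi> \<and>
     \<tau> ` {..<nverts \<Gamma>} \<subseteq> \<Phi> \<and>
     inj_on \<tau> {..<nverts \<Gamma>} \<and> lin_indpt_vec n (\<tau> ` {..<nverts \<Gamma>}) \<and>
     (\<forall>i < nverts \<Gamma>. \<forall>j < nverts \<Gamma>. i \<noteq> j \<longrightarrow> \<tau> i \<bullet> \<tau> j = edge_value \<Gamma> i j)"

definition carter_diagram :: "diagram \<Rightarrow> bool" where
  "carter_diagram \<Gamma> \<longleftrightarrow>
     wf_diagram \<Gamma> \<and> (\<forall>vs. is_cycle \<Gamma> vs \<longrightarrow> even (length vs)) \<and>
     (\<exists>n \<Phi> \<tau>. realizes n \<Phi> \<Gamma> \<tau>)"

(* The connection edge may be solid or dotted. *)
definition simple_extension :: "diagram \<Rightarrow> nat \<Rightarrow> diagram \<Rightarrow> bool" where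
  "simple_extension \<Gamma> p \<Gamma>' \<longleftrightarrow>
     p < nverts \<Gamma> \<and>
     (\<Gamma>' = Diagram (Suc (nverts \<Gamma>)) (insert {p, nverts \<Gamma>} (solid \<Gamma>)) (dotted \<Gamma>) \<or>
      \<Gamma>' = Diagram (Suc (nverts \<Gamma>)) (solid \<Gamma>) (insert {p, nverts \<Gamma>} (dotted \<Gamma>))) \<and>
     carter_diagram \<Gamma>'"

definition labels_vector :: "nat \<Rightarrow> (nat \<Rightarrow> real vec) \<Rightarrow> real vec \<Rightarrow> real vec" where
  "labels_vector l \<tau> \<gamma> = vec l (\<lambda>i. \<gamma> \<bullet> \<tau> i)"

definition linkage_diagram :: "diagram \<Rightarrow> real vec \<Rightarrow> bool" where
  "linkage_diagram \<Gamma> v \<longleftrightarrow> v \<noteq> 0\<^sub>v (nverts \<Gamma>) \<and>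
     (\<exists>n \<Phi> \<tau> \<gamma>. realizes n \<Phi> \<Gamma> \<tau> \<and> \<gamma> \<in> \<Phi> \<and> \<gamma> \<notin> span_vec n (\<tau> ` {..<nverts \<Gamma>}) \<and>
        v = labels_vector (nverts \<Gamma>) \<tau> \<gamma>)"

end

theory Submission
  imports Defs
begin

text \<open>A witness for \<Gamma>' is already a witness for \<Gamma>: keep the root system \<Phi>
  and the root \<gamma>, and forget the last root of \<tau>. The remaining roots stay independent
  and, since the new edge ends at the new vertex, have diagram \<Gamma>
  (\<open>realizes_restrict\<close>, \<open>simple_extension_edge_value\<close>). Their span only
  shrinks, so \<gamma> stays outside it, and its labels are the old ones without the last
  (\<open>vec_first_labels_vector\<close>).\<close>

lemma span_vec_mono: "A \<subseteq> B \<Longrightarrow> span_vec n A \<subseteq> span_vec n B"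
  by (rule LinearCombinations.module.span_is_monotone[OF vec_module])

lemma lin_indpt_vec_subset:
  assumes "lin_indpt_vec n B" "A \<subseteq> B"
  shows "lin_indpt_vec n A"
proof -
  interpret vec_space "TYPE(real)" n .
  show ?thesis
    using assms subset_li_is_li by blast
qed

text \<open>The same \<Phi> and \<tau> serve both diagrams: the realizing roots need not span the
  ambient space, and only the values of \<tau> at vertices matter.\<close>

lemma realizes_restrict:
  assumes real: "realizes n \<Phi> \<Gamma>' \<tau>"
    and le: "nverts \<Gamma> \<le> nverts \<Gamma>'"
    and edges: "\<And>i j. i < nverts \<Gamma> \<Longrightarrow> j < nverts \<Gamma> \<Longrightarrow> edge_value \<Gamma> i j = edge_value \<Gamma>' i j"
  shows "realizes n \<Phi> \<Gamma> \<tau>"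
proof -
  have sub: "{..<nverts \<Gamma>} \<subseteq> {..<nverts \<Gamma>'}"
    using le by auto
  have "lin_indpt_vec n (\<tau> ` {..<nverts \<Gamma>})"
    using real lin_indpt_vec_subset[OF _ image_mono[OF sub]] by (auto simp: realizes_def)
  moreover have "inj_on \<tau> {..<nverts \<Gamma>}"
    using real inj_on_subset[OF _ sub] by (auto simp: realizes_def)
  moreover have "\<tau> ` {..<nverts \<Gamma>} \<subseteq> \<Phi>"
    using real sub by (auto simp: realizes_def)
  ultimately show ?thesis
    using real le edges by (simp add: realizes_def)
qed

lemma simple_extension_nverts:
  "simple_extension \<Gamma> p \<Gamma>' \<Longrightarrow> nverts \<Gamma>' = Suc (nverts \<Gamma>)"
  by (auto simp: simple_extension_def)

lemma simple_extension_edge_value: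
  assumes "simple_extension \<Gamma> p \<Gamma>'" "i < nverts \<Gamma>" "j < nverts \<Gamma>"
  shows "edge_value \<Gamma> i j = edge_value \<Gamma>' i j"
proof -
  \<comment> \<open>The extra vertex has index \<open>nverts \<Gamma>\<close>, which exceeds both
    \<open>i\<close> and \<open>j\<close>.\<close>
  have "{i, j} \<noteq> {p, nverts \<Gamma>}"
    using assms(2,3) by (auto simp: doubleton_eq_iff)
  then show ?thesis
    using assms(1) by (auto simp: simple_extension_def edge_value_def)
qed

text \<open>Each label depends on its own vertex only; \<open>m \<le> l\<close> keeps every index
  read inside the longer vector.\<close>

lemma vec_first_labels_vector:
  "m \<le> l \<Longrightarrow> vec_first (labels_vector l \<tau> \<gamma>) m = labels_vector m \<tau> \<gamma>"
  by (auto simp: vec_first_def labels_vector_def)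

theorem theorem4p5:
  fixes \<Gamma> \<Gamma>' :: diagram and p :: nat and \<gamma>' :: "real vec"
  assumes "carter_diagram \<Gamma>"
    and "simple_extension \<Gamma> p \<Gamma>'"
    and "linkage_diagram \<Gamma>' \<gamma>'"
    and "vec_first \<gamma>' (nverts \<Gamma>) \<noteq> 0\<^sub>v (nverts \<Gamma>)"
  shows "linkage_diagram \<Gamma> (vec_first \<gamma>' (nverts \<Gamma>))"
proof -
  have le: "nverts \<Gamma> \<le> nverts \<Gamma>'"
    using simple_extension_nverts[OF assms(2)] by simp
  obtain n \<Phi> \<tau> \<gamma> where real: "realizes n \<Phi> \<Gamma>' \<tau>" and root: "\<gamma> \<in> \<Phi>"
    and out: "\<gamma> \<notin> span_vec n (\<tau> ` {..<nverts \<Gamma>'})"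
    and lab: "\<gamma>' = labels_vector (nverts \<Gamma>') \<tau> \<gamma>"
    using assms(3) unfolding linkage_diagram_def by blast
  \<comment> \<open>Contrapositive of monotonicity: lying in the smaller span would put \<gamma> in
    the larger one.\<close>
  have "\<gamma> \<notin> span_vec n (\<tau> ` {..<nverts \<Gamma>})"
    using out span_vec_mono[OF image_mono, of "{..<nverts \<Gamma>}" "{..<nverts \<Gamma>'}" n \<tau>] le
    by auto
  moreover have "realizes n \<Phi> \<Gamma> \<tau>"
    by (rule realizes_restrict[OF real le simple_extension_edge_value[OF assms(2)]])
  moreover have "vec_first \<gamma>' (nverts \<Gamma>) = labels_vector (nverts \<Gamma>) \<tau> \<gamma>"
    unfolding lab using le by (rule vec_first_labels_vector)
  ultimately show ?thesis
    using root assms(4) unfolding linkage_diagram_def by blast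
qed

end
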